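(* Let $H$ be a digraph (possibly with loops), $D$ a strongly connected $H$-colored digraph, and $\mathscr{F}$ a walk-preservative $H$-class partition of $A(D)$ such that $C_{\mathscr{F}}(D)$ has a $(k,l)$-kernel $\mathcal{S}$ (with $k\ge 2$, $l\ge 1$). Suppose that: (a) every cycle in $C_{\mathscr{F}}(D)$ is either a loop or has length at least $k$; and (b) for every $x\in V(D)$ with $N_{\mathscr{F}}(x)\cap\mathcal{S}\neq\emptyset$ and $N_{\mathscr{F}}(x)\cap N^{+}(\mathcal{S})\neq\emptyset$, we have $N^{-}_{\mathscr{F}}(x)\subseteq\mathcal{S}$. Then $D$ has a $(k,l+1,H)$-kernel by walks.
   Context: An $H$-colored digraph is a finite digraph $D$ without loops with a coloring $\rho:A(D)\to V(H)$. For $F\subseteq A(D)$, $D\langle F\rangle$ is the digraph with arc set $F$ and vertex set the vertices incident with an arc of $F$. An $H$-class partition of $A(D)$ is a partition $\mathscr{F}$ of $A(D)$ such that for all arcs $(u,v),(v,w)$ of $D$, $(\rho(u,v),\rho(v,w))\in A(H)$ iff some $F\in\mathscr{F}$ contains both arcs. The $H$-class digraph $C_{\mathscr{F}}(D)$ has vertex set $\mathscr{F}$, and $(F,G)$ (possibly a loop) is an arc iff there exist $(u,v)\in F$ and $(v,w)\in G$. $\mathscr{F}$ is walk-preservative if for every arc $(F,G)$ of $C_{\mathscr{F}}(D)$ and every $z\in V(D\langle F\rangle)$ there is a $zw$-path in $D\langle F\rangle$ for some $w\in V(D\langle G\rangle)$. For $x\in V(D)$: $N^-_{\mathscr{F}}(x)=\{F\in\mathscr{F}:(u,x)\in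 F \text{ for some } u\}$, $N^+_{\mathscr{F}}(x)=\{F\in\mathscr{F}:(x,v)\in F\text{ for some }v\}$, $N_{\mathscr{F}}(x)=N^+_{\mathscr{F}}(x)\cup N^-_{\mathscr{F}}(x)$. $N^+(\mathcal{S})$ is the proper out-neighborhood of $\mathcal{S}$ in $C_{\mathscr{F}}(D)$ (vertices outside $\mathcal{S}$ receiving an arc from $\mathcal{S}$). A $(k,l)$-kernel of a digraph is a set $S$ such that every walk between two different vertices of $S$ has length at least $k$ and every vertex not in $S$ has a walk of length at most $l$ to $S$. For a walk $W=(x_0,\ldots,x_n)$ in $D$, there is an obstruction on $x_i$ if $(\rho(x_{i-1},x_i),\rho(x_i,x_{i+1}))\notin A(H)$; for open $W$, $l_H(W)$ is $1$ plus the number of $i\in\{1,\dots,n-1\}$ with an obstruction on $x_i$. A set $S\subseteq V(D)$ is a $(k,l,H)$-kernel by walks if every walk between two different vertices of $S$ has $H$-length at least $k$ and every $x\notin S$ has a walk to $S$ of $H$-length at most $l$. *)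

theory Defs
  imports "Graph_Theory.Graph_Theory"
begin

definition H_colored_digraph ::
  "'c pair_pre_digraph \<Rightarrow> 'a pair_pre_digraph \<Rightarrow> ('a \<times> 'a \<Rightarrow> 'c) \<Rightarrow> bool" where
  "H_colored_digraph H D \<rho> \<longleftrightarrow>
     pair_wf_digraph H \<and> pair_digraph D \<and> (\<forall>e \<in> parcs D. \<rho> e \<in> pverts H)"

definition arc_induced :: "('a \<times> 'a) set \<Rightarrow> 'a pair_pre_digraph" where
  "arc_induced F = \<lparr> pverts = fst ` F \<union> snd ` F, parcs = F \<rparr>"

definition H_class_partition ::
  "'c pair_pre_digraph \<Rightarrow> 'a pair_pre_digraph \<Rightarrow> ('a \<times> 'a \<Rightarrow> 'c) \<Rightarrow> ('a \<times> 'a) set set \<Rightarrow> bool" where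
  "H_class_partition H D \<rho> \<F> \<longleftrightarrow>
     partition_on (parcs D) \<F> \<and>
     (\<forall>u v w. (u, v) \<in> parcs D \<longrightarrow> (v, w) \<in> parcs D \<longrightarrow>
        ((\<rho> (u, v), \<rho> (v, w)) \<in> parcs H \<longleftrightarrow> (\<exists>F \<in> \<F>. (u, v) \<in> F \<and> (v, w) \<in> F)))"

definition class_digraph :: "('a \<times> 'a) set set \<Rightarrow> ('a \<times> 'a) set pair_pre_digraph" where
  "class_digraph \<F> =
     \<lparr> pverts = \<F>,
       parcs = {(F, G). F \<in> \<F> \<and> G \<in> \<F> \<and> (\<exists>u v w. (u, v) \<in> F \<and> (v, w) \<in> G)} \<rparr>"

(* The path may be trivial: if z already is a vertex of the digraph induced by G, take w = z. *)
definition walk_preservative :: "('a \<times> 'a) set set \<Rightarrow> bool" where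
  "walk_preservative \<F> \<longleftrightarrow>
     (\<forall>F G. (F, G) \<in> parcs (class_digraph \<F>) \<longrightarrow>
        (\<forall>z \<in> pverts (arc_induced F). \<exists>w \<in> pverts (arc_induced G).
           \<exists>p. pre_digraph.apath (arc_induced F) z p w))"

definition in_classes :: "('a \<times> 'a) set set \<Rightarrow> 'a \<Rightarrow> ('a \<times> 'a) set set" where
  "in_classes \<F> x = {F \<in> \<F>. \<exists>u. (u, x) \<in> F}"

definition out_classes :: "('a \<times> 'a) set set \<Rightarrow> 'a \<Rightarrow> ('a \<times> 'a) set set" where
  "out_classes \<F> x = {F \<in> \<F>. \<exists>v. (x, v) \<in> F}"

definition classes_at :: "('a \<times> 'a) set set \<Rightarrow> 'a \<Rightarrow> ('a \<times> 'a) set set" where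
  "classes_at \<F> x = out_classes \<F> x \<union> in_classes \<F> x"

definition proper_out_nbhd :: "'v pair_pre_digraph \<Rightarrow> 'v set \<Rightarrow> 'v set" where
  "proper_out_nbhd C S = {v \<in> pverts C - S. \<exists>u \<in> S. (u, v) \<in> parcs C}"

definition kl_kernel :: "'v pair_pre_digraph \<Rightarrow> nat \<Rightarrow> nat \<Rightarrow> 'v set \<Rightarrow> bool" where
  "kl_kernel C k l S \<longleftrightarrow>
     S \<subseteq> pverts C \<and>
     (\<forall>u \<in> S. \<forall>v \<in> S. u \<noteq> v \<longrightarrow> (\<forall>p. pre_digraph.awalk C u p v \<longrightarrow> k \<le> length p)) \<and>
     (\<forall>u \<in> pverts C - S. \<exists>v \<in> S. \<exists>p. pre_digraph.awalk C u p v \<and> length p \<le> l)"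

(* A walk is given by its list of arcs, so consecutive entries of the list meet in an internal
   vertex. Only open walks are covered: for a closed walk an obstruction at the common end
   vertex would have to be counted as well. *)
definition H_length :: "'c pair_pre_digraph \<Rightarrow> ('a \<times> 'a \<Rightarrow> 'c) \<Rightarrow> ('a \<times> 'a) list \<Rightarrow> nat" where
  "H_length H \<rho> p = 1 + card {i. Suc i < length p \<and> (\<rho> (p ! i), \<rho> (p ! Suc i)) \<notin> parcs H}"

definition klH_kernel_by_walks ::
  "'c pair_pre_digraph \<Rightarrow> 'a pair_pre_digraph \<Rightarrow> ('a \<times> 'a \<Rightarrow> 'c) \<Rightarrow> nat \<Rightarrow> nat \<Rightarrow> 'a set \<Rightarrow> bool" where
  "klH_kernel_by_walks H D \<rho> k l S \<longleftrightarrow>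
     S \<subseteq> pverts D \<and>
     (\<forall>u \<in> S. \<forall>v \<in> S. u \<noteq> v \<longrightarrow>
        (\<forall>p. pre_digraph.awalk D u p v \<longrightarrow> k \<le> H_length H \<rho> p)) \<and>
     (\<forall>x \<in> pverts D - S. \<exists>v \<in> S. \<exists>p. pre_digraph.awalk D x p v \<and> H_length H \<rho> p \<le> l)"

end

theory Submission
  imports Defs
begin

text \<open>
  Let \<open>F\<close> be a class in the kernel \<open>\<S>\<close>. In every terminal strong component of \<open>D\<langle>F\<rangle>\<close> pick one
  vertex all of whose in-classes lie in \<open>\<S>\<close>; the picked vertices form the kernel by walks.
  Such a vertex exists: otherwise hypothesis (b) forces every arc leaving the component to be in
  \<open>F\<close>, so by strong connectivity the component is all of \<open>D\<close> and \<open>F\<close> is the only class.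

  Contracting each monochromatic stretch of a walk of \<open>H\<close>-length \<open>n\<close> to its class yields a
  loopless walk of length \<open>n - 1\<close> in \<open>C\<^sub>\<F>(D)\<close>. If it joins picked vertices, it ends in \<open>\<S>\<close>; if it
  does not start in \<open>\<S>\<close>, it can be extended backwards by an in-class of its first vertex, which
  is in \<open>\<S>\<close>. The kernel property (for different ends) or (a) (for equal ends) then gives \<open>n \<ge> k\<close>.
  Only a walk inside a single class of \<open>\<S>\<close> escapes this argument, and it would have to stay in the
  terminal component of its first vertex, where only one vertex was picked.
  Absorption follows a walk of \<open>C\<^sub>\<F>(D)\<close> to \<open>\<S>\<close> by walk-preservation, at the cost of one more
  monochromatic stretch inside the final class.
\<close>

section \<open>Reachability in finite relations\<close>

text \<open>Membership in a terminal strong component, which then consists of all vertices reachable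
  from \<open>y\<close>.\<close>

definition terminal_in :: "'a rel \<Rightarrow> 'a \<Rightarrow> bool" where
  "terminal_in r y \<longleftrightarrow> (\<forall>z. (y, z) \<in> r\<^sup>* \<longrightarrow> (z, y) \<in> r\<^sup>*)"

lemma finite_rtrancl_Image: "finite r \<Longrightarrow> finite (r\<^sup>* `` {x})"
proof (rule finite_subset)
  show "r\<^sup>* `` {x} \<subseteq> insert x (Range r)"
    by (auto elim: rtranclE)
qed (simp add: finite_Range)

text \<open>Take a reachable vertex whose own reachable set is smallest: whatever it reaches cannot
  reach fewer vertices.\<close>

lemma terminal_in_reachable:
  assumes "finite r"
  obtains y where "(x, y) \<in> r\<^sup>*" "terminal_in r y"
proof -
  obtain y where y: "(x, y) \<in> r\<^sup>*"
    and min: "\<And>z. (x, z) \<in> r\<^sup>* \<Longrightarrow> card (r\<^sup>* `` {y}) \<le> card (r\<^sup>* `` {z})"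
    using ex_has_least_nat[of "\<lambda>y. (x, y) \<in> r\<^sup>*" x "\<lambda>y. card (r\<^sup>* `` {y})"] by blast
  have "(z, y) \<in> r\<^sup>*" if yz: "(y, z) \<in> r\<^sup>*" for z
  proof -
    have "r\<^sup>* `` {z} \<subseteq> r\<^sup>* `` {y}" using yz by auto
    moreover have "card (r\<^sup>* `` {y}) \<le> card (r\<^sup>* `` {z})"
      using min y yz by (meson rtrancl_trans)
    ultimately have "r\<^sup>* `` {z} = r\<^sup>* `` {y}"
      using finite_rtrancl_Image[OF assms] by (intro card_seteq) auto
    then show ?thesis by auto
  qed
  with y that show thesis by (auto simp: terminal_in_def)
qed

lemma terminal_in_step: "terminal_in r y \<Longrightarrow> (y, z) \<in> r\<^sup>* \<Longrightarrow> terminal_in r z"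
  unfolding terminal_in_def by (meson rtrancl_trans)

lemma terminal_in_Image_eq:
  "terminal_in r y \<Longrightarrow> (y, z) \<in> r\<^sup>* \<Longrightarrow> r\<^sup>* `` {z} = r\<^sup>* `` {y}"
  unfolding terminal_in_def by (auto intro: rtrancl_trans)

text \<open>If \<open>y\<close> has an out-arc, the way back from its head ends with an arc into
  \<open>y\<close>, or the out-arc is a loop.\<close>

lemma terminal_in_Range: "terminal_in r y \<Longrightarrow> y \<in> Field r \<Longrightarrow> y \<in> Range r"
  unfolding terminal_in_def Field_def by (blast elim: rtranclE)

lemma rtrancl_Field: "(x, y) \<in> r\<^sup>* \<Longrightarrow> x \<in> Field r \<Longrightarrow> y \<in> Field r"
  by (induct rule: rtrancl_induct) (auto simp: Field_def)

section \<open>The \<open>H\<close>-length\<close>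

lemma H_length_Nil [simp]: "H_length H \<rho> [] = 1"
  by (simp add: H_length_def)

lemma H_length_single [simp]: "H_length H \<rho> [e] = 1"
  by (simp add: H_length_def)

lemma H_length_Cons_Cons:
  "H_length H \<rho> (e # f # p) =
     (if (\<rho> e, \<rho> f) \<in> parcs H then 0 else 1) + H_length H \<rho> (f # p)"
proof -
  let ?O = "\<lambda>q. {i. Suc i < length q \<and> (\<rho> (q ! i), \<rho> (q ! Suc i)) \<notin> parcs H}"
  have fin: "finite (?O q)" for q
    by (rule finite_subset[of _ "{..<length q}"]) auto
  have "?O (e # f # p) = (if (\<rho> e, \<rho> f) \<in> parcs H then {} else {0}) \<union> Suc ` ?O (f # p)"
    (is "?A = ?B")
  proof (rule set_eqI)
    show "i \<in> ?A \<longleftrightarrow> i \<in> ?B" for i by (cases i) (auto simp: image_iff)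
  qed
  then have "card (?O (e # f # p)) =
      (if (\<rho> e, \<rho> f) \<in> parcs H then 0 else 1) + card (Suc ` ?O (f # p))"
    using fin[of "f # p"] by (auto simp: card_insert_if)
  then show ?thesis by (simp add: H_length_def card_image)
qed

text \<open>The second leading 1 pays for a possible obstruction where the two walks meet.\<close>

lemma H_length_append_le: "H_length H \<rho> (p @ q) \<le> H_length H \<rho> p + H_length H \<rho> q"
proof (induct p rule: induct_list012)
  case (2 e)
  then show ?case by (cases q) (auto simp: H_length_Cons_Cons)
qed (auto simp: H_length_Cons_Cons)

section \<open>Walks and their classes\<close>

lemma pcas_hd_last:
  "pcas x p y \<Longrightarrow> p \<noteq> [] \<Longrightarrow> fst (hd p) = x \<and> snd (last p) = y"
  by (induct p arbitrary: x) (auto split: if_splits)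

lemma pcas_rtrancl: "pcas x p y \<Longrightarrow> set p \<subseteq> r \<Longrightarrow> (x, y) \<in> r\<^sup>*"
proof (induct p arbitrary: x)
  case (Cons e p)
  then show ?case
    by (cases e) (auto intro: converse_rtrancl_into_rtrancl)
qed auto

lemma rtrancl_pcas:
  assumes "(x, y) \<in> r\<^sup>*"
  obtains p where "pcas x p y" "set p \<subseteq> r"
  using assms
proof (induct arbitrary: thesis rule: converse_rtrancl_induct)
  case base
  show ?case by (rule base[of "[]"]) auto
next
  case (step u v)
  from step(3) obtain p where "pcas v p y" "set p \<subseteq> r" .
  with step(1) show ?case by (intro step(4)[of "(u, v) # p"]) auto
qed

lemma pcas_append: "pcas x p y \<Longrightarrow> pcas y q z \<Longrightarrow> pcas x (p @ q) z"
  by (induct p arbitrary: x) auto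

lemma awalk_pcas:
  "pre_digraph.awalk (with_proj G) u p v \<longleftrightarrow> u \<in> pverts G \<and> set p \<subseteq> parcs G \<and> pcas u p v"
  by (simp add: pre_digraph.awalk_def cas_with_proj_eq)

text \<open>Carries the lower bound (a) from cycles over to closed walks, which are shortened to
  cycles.\<close>

lemma (in wf_digraph) length_awalk_to_apath:
  assumes "awalk u p v"
  shows "length (awalk_to_apath p) \<le> length p"
  using assms
proof (induct rule: awalk_to_apath_induct)
  case (path p)
  then show ?case by (auto simp: awalk_to_apath.simps)
next
  case (decomp p q r s)
  then have "p = q @ r @ s" by (auto elim: awalk_cyc_decompE)
  with decomp show ?case using step_awalk_to_apath[of u p v q r s] by simp
qed

locale H_classes = pair_digraph D
  for D :: "'a pair_pre_digraph" +
  fixes H :: "'c pair_pre_digraph"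
    and \<rho> :: "'a \<times> 'a \<Rightarrow> 'c"
    and \<F> :: "('a \<times> 'a) set set"
  assumes class_partition: "H_class_partition H D \<rho> \<F>"
begin

sublocale C: pair_wf_digraph "class_digraph \<F>"
  by unfold_locales (auto simp: class_digraph_def)

lemma pverts_class_digraph [simp]: "pverts (class_digraph \<F>) = \<F>"
  by (simp add: class_digraph_def)

lemma class_arcI: "F \<in> \<F> \<Longrightarrow> G \<in> \<F> \<Longrightarrow> (u, v) \<in> F \<Longrightarrow> (v, w) \<in> G \<Longrightarrow> (F, G) \<in> parcs (class_digraph \<F>)"
  by (auto simp: class_digraph_def)

lemma class_subset: "F \<in> \<F> \<Longrightarrow> F \<subseteq> parcs D"
  using class_partition by (auto simp: H_class_partition_def dest: partition_onD1)

lemma finite_class: "F \<in> \<F> \<Longrightarrow> finite F"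
  using class_subset pair_finite_arcs finite_subset by blast

lemma class_unique: "F \<in> \<F> \<Longrightarrow> G \<in> \<F> \<Longrightarrow> e \<in> F \<Longrightarrow> e \<in> G \<Longrightarrow> F = G"
  using class_partition by (auto simp: H_class_partition_def partition_on_def disjoint_def)

lemma class_of_arc:
  assumes "e \<in> parcs D"
  obtains F where "F \<in> \<F>" "e \<in> F"
proof -
  have "e \<in> \<Union>\<F>"
    using assms class_partition by (auto simp: H_class_partition_def partition_on_def)
  with that show thesis by blast
qed

lemma Field_class_subset: "F \<in> \<F> \<Longrightarrow> Field F \<subseteq> pverts D"
  using class_subset wellformed' by (fastforce simp: Field_def)

text \<open>Classes are disjoint, so obstructions are exactly the changes of class.\<close>

lemma H_arc_iff:
  assumes "F \<in> \<F>" "G \<in> \<F>" "(u, v) \<in> F" "(v, w) \<in> G"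
  shows "(\<rho> (u, v), \<rho> (v, w)) \<in> parcs H \<longleftrightarrow> F = G"
proof -
  have "(u, v) \<in> parcs D" "(v, w) \<in> parcs D" using assms class_subset by auto
  then have "(\<rho> (u, v), \<rho> (v, w)) \<in> parcs H \<longleftrightarrow> (\<exists>F\<in>\<F>. (u, v) \<in> F \<and> (v, w) \<in> F)"
    using class_partition by (auto simp: H_class_partition_def)
  then show ?thesis using assms class_unique by metis
qed

lemma H_length_in_class:
  assumes "F \<in> \<F>"
  shows "pcas x p y \<Longrightarrow> set p \<subseteq> F \<Longrightarrow> H_length H \<rho> p = 1"
proof (induct p arbitrary: x rule: induct_list012)
  case (3 e f p)
  obtain u v w where ef: "e = (u, v)" "f = (v, w)"
    using "3.prems"(1) by (cases e; cases f) auto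
  have "(\<rho> e, \<rho> f) \<in> parcs H" using H_arc_iff[OF assms assms] "3.prems"(2) ef by auto
  moreover have "H_length H \<rho> (f # p) = 1" using "3.prems" by (intro "3.hyps"(2)) auto
  ultimately show ?case by (simp add: H_length_Cons_Cons)
qed auto

lemma walk_in_class:
  assumes "F \<in> \<F>" "(x, y) \<in> F\<^sup>*" "x \<in> pverts D"
  obtains p where "awalk x p y" "H_length H \<rho> p = 1"
proof -
  obtain p where p: "pcas x p y" "set p \<subseteq> F" using rtrancl_pcas[OF assms(2)] .
  then have "awalk x p y" using assms(3) class_subset[OF assms(1)] by (auto simp: awalk_pcas)
  then show thesis using H_length_in_class[OF assms(1) p] that by blast
qed

text \<open>\<open>q\<close> records the changes of class along \<open>p\<close>, one arc per
  obstruction, hence the \<open>Suc\<close>. The last conjunct isolates walks without a change,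
  which need a separate argument.\<close>

lemma class_walk_of_walk:
  assumes "pcas x p y" "set p \<subseteq> parcs D" "p \<noteq> []" "A \<in> \<F>" "hd p \<in> A"
  shows "\<exists>B q. B \<in> \<F> \<and> last p \<in> B \<and> C.awalk A q B \<and> Suc (length q) = H_length H \<rho> p \<and>
           (\<forall>(X, Y) \<in> set q. X \<noteq> Y) \<and> (q = [] \<longrightarrow> set p \<subseteq> A)"
  using assms
proof (induct p arbitrary: x A rule: induct_list012)
  case (2 e)
  then show ?case by (intro exI[of _ A] exI[of _ "[]"]) (auto simp: awalk_pcas)
next
  case (3 e f p)
  obtain u v w where ef: "e = (u, v)" "f = (v, w)"
    using "3.prems"(1) by (cases e; cases f) auto
  obtain A' where A': "A' \<in> \<F>" "f \<in> A'"
    using class_of_arc[of f] "3.prems"(2) by auto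
  obtain B q where Bq: "B \<in> \<F>" "last (f # p) \<in> B" "C.awalk A' q B"
      "Suc (length q) = H_length H \<rho> (f # p)" "\<forall>(X, Y) \<in> set q. X \<noteq> Y"
      "q = [] \<longrightarrow> set (f # p) \<subseteq> A'"
    using "3.hyps"(2)[of "snd e" A'] "3.prems" A' by auto
  have e: "e \<in> A" using "3.prems"(5) by simp
  have arc: "(A, A') \<in> parcs (class_digraph \<F>)"
    using class_arcI[of A A' u v w] "3.prems"(4) A' e ef by auto
  have H: "(\<rho> e, \<rho> f) \<in> parcs H \<longleftrightarrow> A = A'"
    using H_arc_iff[of A A' u v w] "3.prems"(4) A' e ef by auto
  show ?case
  proof (cases "A = A'")
    case True
    with Bq H e show ?thesis
      by (intro exI[of _ B] exI[of _ q]) (auto simp: H_length_Cons_Cons)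
  next
    case False
    with Bq H arc "3.prems"(4) show ?thesis
      by (intro exI[of _ B] exI[of _ "(A, A') # q"]) (auto simp: H_length_Cons_Cons awalk_pcas)
  qed
qed simp

end

section \<open>Walks between kernel classes\<close>

locale H_classes_kernel = H_classes +
  fixes \<S> :: "('a \<times> 'a) set set"
    and k l :: nat
  assumes conn: "strongly_connected D"
    and preservative: "walk_preservative \<F>"
    and k2: "k \<ge> 2"
    and kernel: "kl_kernel (class_digraph \<F>) k l \<S>"
    and cycles: "\<And>p. C.cycle p \<Longrightarrow> length p = 1 \<or> k \<le> length p"
    and nbhd: "\<And>x. x \<in> pverts D \<Longrightarrow> classes_at \<F> x \<inter> \<S> \<noteq> {} \<Longrightarrow>
           classes_at \<F> x \<inter> proper_out_nbhd (class_digraph \<F>) \<S> \<noteq> {} \<Longrightarrow>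
           in_classes \<F> x \<subseteq> \<S>"
begin

lemma vertices_rtrancl:
  assumes "x \<in> pverts D" "y \<in> pverts D"
  shows "(x, y) \<in> (parcs D)\<^sup>*"
proof -
  have "x \<rightarrow>\<^sup>*\<^bsub>D\<^esub> y" using conn assms by (auto simp: strongly_connected_def)
  from reachable_rtranclI[OF this] show ?thesis by simp
qed

lemma kernel_subset: "F \<in> \<S> \<Longrightarrow> F \<in> \<F>"
  using kernel by (auto simp: kl_kernel_def)

lemma kernel_walk_length:
  assumes "F \<in> \<S>" "G \<in> \<S>" "C.awalk F q G" "q \<noteq> []" "\<forall>(X, Y) \<in> set q. X \<noteq> Y"
  shows "k \<le> length q"
proof (cases "F = G")
  case False
  then show ?thesis using kernel assms by (auto simp: kl_kernel_def)
next
  case True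
  \<comment> \<open>The first arc is not a loop; the rest is shortened to a path, which this arc
    closes to a cycle.\<close>
  obtain A q' where q: "q = (F, A) # q'" "F \<noteq> A"
  proof (cases q)
    case (Cons e q')
    then show thesis using assms(3,5) that by (cases e) (simp add: awalk_pcas)
  qed (use assms(4) in simp)
  then have w: "C.awalk A q' F" using assms(3) True by (auto simp: C.awalk_Cons_iff)
  let ?r = "C.awalk_to_apath q'"
  have r: "C.apath A ?r F" by (rule C.apath_awalk_to_apath[OF w])
  then have "C.cycle ((F, A) # ?r)"
    using q assms(3) unfolding C.cycle_def C.apath_def
    by (intro exI[of _ F]) (auto simp: C.awalk_Cons_iff)
  \<comment> \<open>The cycle thus has length at least 2, which excludes the loop alternative in
    (a).\<close>
  moreover have "?r \<noteq> []" using r q(2) by (auto simp: C.apath_Nil_iff)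
  ultimately have "k \<le> Suc (length ?r)" using cycles by fastforce
  also have "length ?r \<le> length q'" using C.length_awalk_to_apath[OF w] .
  finally show ?thesis using q(1) by simp
qed

lemma kernel_adjacent_eq:
  assumes "F \<in> \<S>" "G \<in> \<S>" "(F, G) \<in> parcs (class_digraph \<F>)"
  shows "F = G"
proof (rule ccontr)
  assume "F \<noteq> G"
  moreover have "C.awalk F [(F, G)] G"
    using assms kernel_subset by (auto simp: awalk_pcas)
  ultimately have "k \<le> length [(F, G)]" using assms by (intro kernel_walk_length) auto
  with k2 show False by simp
qed

section \<open>Choosing vertices in terminal components\<close>

lemma terminal_vertex_in_classes_subset:
  assumes "F \<in> \<S>" "y \<in> Field F" "terminal_in F y"
  shows "\<exists>c. (y, c) \<in> F\<^sup>* \<and> in_classes \<F> c \<subseteq> \<S>"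
proof (rule ccontr)
  assume none: "\<not> ?thesis"
  have F: "F \<in> \<F>" using assms(1) by (rule kernel_subset)
  have out: "(c, w) \<in> F" if yc: "(y, c) \<in> F\<^sup>*" and cw: "(c, w) \<in> parcs D" for c w
  proof -
    obtain u where uc: "(u, c) \<in> F"
      using terminal_in_Range[of F c] terminal_in_step[OF assms(3) yc] rtrancl_Field[OF yc] assms(2)
      by auto
    obtain B where B: "B \<in> \<F>" "(c, w) \<in> B" using class_of_arc[OF cw] .
    have arc: "(F, B) \<in> parcs (class_digraph \<F>)" using class_arcI F B uc by blast
    \<comment> \<open>Both \<open>F\<close> and \<open>B\<close> occur at \<open>c\<close>. With
      \<open>B\<close> a proper out-neighbour of the kernel, (b) would make \<open>c\<close> a
      suitable vertex, against \<open>none\<close>.\<close>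
    have "B \<in> \<S>"
    proof (rule ccontr)
      assume "B \<notin> \<S>"
      then have "B \<in> proper_out_nbhd (class_digraph \<F>) \<S>"
        using B arc assms(1) by (auto simp: proper_out_nbhd_def)
      moreover have "B \<in> classes_at \<F> c" "F \<in> classes_at \<F> c"
        using B F uc by (auto simp: classes_at_def out_classes_def in_classes_def)
      ultimately have "in_classes \<F> c \<subseteq> \<S>"
        using nbhd[of c] assms(1) wellformed'(1)[OF cw] by blast
      with none yc show False by blast
    qed
    then show ?thesis using kernel_adjacent_eq[OF assms(1) _ arc] B by simp
  qed
  have y: "y \<in> pverts D" using assms(2) F Field_class_subset by auto
  have reach: "(y, c) \<in> F\<^sup>*" if "c \<in> pverts D" for c
  proof -
    from y that have "(y, c) \<in> (parcs D)\<^sup>*" by (rule vertices_rtrancl)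
    then show ?thesis
      by (induct rule: rtrancl_induct) (auto intro: rtrancl_into_rtrancl out)
  qed
  \<comment> \<open>As \<open>y\<close> itself is unsuitable, some arc into it has a class outside
    \<open>\<S>\<close>; but its tail is reachable from \<open>y\<close> in \<open>F\<close>, so
    \<open>out\<close> puts that arc in \<open>F\<close>.\<close>
  obtain A u where A: "A \<in> \<F>" "A \<notin> \<S>" "(u, y) \<in> A"
  proof -
    have "\<not> in_classes \<F> y \<subseteq> \<S>" using none by blast
    with that show thesis by (auto simp: in_classes_def)
  qed
  then have uy: "(u, y) \<in> parcs D" using class_subset by auto
  have "(u, y) \<in> F" using out[OF reach uy] wellformed'(1)[OF uy] .
  with A F have "A = F" using class_unique by blast
  with A(2) assms(1) show False by simp
qed

text \<open>The argument is the component as a set, so the choice is the same from each of its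
  vertices.\<close>

definition picked :: "('a \<times> 'a) set \<Rightarrow> 'a set \<Rightarrow> 'a" where
  "picked F T = (SOME c. c \<in> T \<and> in_classes \<F> c \<subseteq> \<S>)"

text \<open>
  The last conjunct makes \<open>n\<close> the representative of its own component, so that two picked vertices
  of the same component coincide.
\<close>

definition picked_vertices :: "'a set" where
  "picked_vertices =
     {n. \<exists>F\<in>\<S>. n \<in> Field F \<and> terminal_in F n \<and> in_classes \<F> n \<subseteq> \<S> \<and> n = picked F (F\<^sup>* `` {n})}"

lemma picked_reachable:
  assumes "F \<in> \<S>" "x \<in> Field F"
  obtains n where "n \<in> picked_vertices" "(x, n) \<in> F\<^sup>*"
proof -
  obtain y where y: "(x, y) \<in> F\<^sup>*" "terminal_in F y"
    using terminal_in_reachable finite_class kernel_subset assms(1) by metis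
  then have yF: "y \<in> Field F" using rtrancl_Field assms(2) by metis
  define n where "n = picked F (F\<^sup>* `` {y})"
  have n: "(y, n) \<in> F\<^sup>*" "in_classes \<F> n \<subseteq> \<S>"
    using someI_ex[of "\<lambda>c. c \<in> F\<^sup>* `` {y} \<and> in_classes \<F> c \<subseteq> \<S>"]
      terminal_vertex_in_classes_subset[OF assms(1) yF y(2)]
    unfolding n_def picked_def by auto
  \<comment> \<open>\<open>n\<close> lies in the component of \<open>y\<close>, so choosing again
    from \<open>n\<close> returns \<open>n\<close>.\<close>
  have "n = picked F (F\<^sup>* `` {n})"
    using terminal_in_Image_eq[OF y(2) n(1)] n_def by simp
  then have "n \<in> picked_vertices"
    using assms(1) n terminal_in_step[OF y(2) n(1)] rtrancl_Field[OF n(1) yF]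
    unfolding picked_vertices_def by blast
  moreover have "(x, n) \<in> F\<^sup>*" using y(1) n(1) by simp
  ultimately show thesis by (rule that)
qed

section \<open>Independence of the picked vertices\<close>

lemma picked_in_arc:
  assumes "n \<in> picked_vertices"
  obtains F u where "F \<in> \<S>" "(u, n) \<in> F" "terminal_in F n" "n = picked F (F\<^sup>* `` {n})"
proof -
  obtain F where "F \<in> \<S>" "n \<in> Field F" "terminal_in F n" "n = picked F (F\<^sup>* `` {n})"
    using assms unfolding picked_vertices_def by blast
  then show thesis using terminal_in_Range[of F n] that by blast
qed

lemma picked_in_classes: "n \<in> picked_vertices \<Longrightarrow> in_classes \<F> n \<subseteq> \<S>"
  by (auto simp: picked_vertices_def)

text \<open>Adjacent kernel classes coincide, so both ends were picked for \<open>G\<close> itself,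
  and from the same terminal component.\<close>

lemma picked_eq:
  assumes "x \<in> picked_vertices" "y \<in> picked_vertices" "pcas x p y" "p \<noteq> []"
    "set p \<subseteq> G" "G \<in> \<S>"
  shows "x = y"
proof -
  have G: "G \<in> \<F>" using assms(6) by (rule kernel_subset)
  have xy: "(x, y) \<in> G\<^sup>*" using pcas_rtrancl assms(3,5) by metis
  obtain v where xv: "(x, v) \<in> G"
    using assms(3-5) by (cases p) auto
  obtain F u where F: "F \<in> \<S>" "(u, x) \<in> F" "terminal_in F x" "x = picked F (F\<^sup>* `` {x})"
    using picked_in_arc[OF assms(1)] .
  have "F = G"
    using kernel_adjacent_eq[OF F(1) assms(6)] class_arcI[OF _ G F(2) xv] kernel_subset[OF F(1)]
    by simp
  with F have x: "terminal_in G x" "x = picked G (G\<^sup>* `` {x})" by auto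
  obtain F' u' where F': "F' \<in> \<S>" "(u', y) \<in> F'" "y = picked F' (F'\<^sup>* `` {y})"
    using picked_in_arc[OF assms(2)] .
  \<comment> \<open>The way back is trivial or starts with an arc of \<open>G\<close> leaving
    \<open>y\<close>, which identifies \<open>F'\<close> with \<open>G\<close>.\<close>
  from x(1) xy have "(y, x) \<in> G\<^sup>*" by (simp add: terminal_in_def)
  then show ?thesis
  proof (cases rule: converse_rtranclE)
    case (step z)
    have "F' = G"
      using kernel_adjacent_eq[OF F'(1) assms(6)] class_arcI[OF _ G F'(2) step(1)]
        kernel_subset[OF F'(1)] by simp
    with F'(3) x(2) terminal_in_Image_eq[OF x(1) xy] show ?thesis by simp
  qed simp
qed

lemma picked_independent:
  assumes x: "x \<in> picked_vertices" and y: "y \<in> picked_vertices" and "x \<noteq> y"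
    and p: "awalk x p y"
  shows "k \<le> H_length H \<rho> p"
proof -
  have pc: "pcas x p y" and sp: "set p \<subseteq> parcs D" using p by (auto simp: awalk_pcas)
  then have ne: "p \<noteq> []" using \<open>x \<noteq> y\<close> by auto
  note ends = pcas_hd_last[OF pc ne]
  obtain A where A: "A \<in> \<F>" "hd p \<in> A"
    using class_of_arc[of "hd p"] sp ne hd_in_set by blast
  obtain B q where Bq: "B \<in> \<F>" "last p \<in> B" "C.awalk A q B" "Suc (length q) = H_length H \<rho> p"
      "\<forall>(X, Y) \<in> set q. X \<noteq> Y" "q = [] \<longrightarrow> set p \<subseteq> A"
    using class_walk_of_walk[OF pc sp ne A] by blast
  have "B \<in> in_classes \<F> y"
    using Bq(1,2) ends by (auto simp: in_classes_def intro: exI[of _ "fst (last p)"])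
  then have B: "B \<in> \<S>" using picked_in_classes[OF y] by auto
  show ?thesis
  proof (cases "A \<in> \<S>")
    case True
    have "q \<noteq> []" using picked_eq[OF x y pc ne _ True] Bq(6) \<open>x \<noteq> y\<close> by auto
    then have "k \<le> length q" using kernel_walk_length[OF True B Bq(3)] Bq(5) by simp
    with Bq(4) show ?thesis by simp
  next
    case False
    \<comment> \<open>Prepending \<open>(F, A)\<close> gives length \<open>Suc (length q)\<close>,
      exactly the H-length of \<open>p\<close>.\<close>
    obtain F u where F: "F \<in> \<S>" "(u, x) \<in> F" using picked_in_arc[OF x] .
    have "(x, snd (hd p)) \<in> A" using A(2) ends by (cases "hd p") simp
    then have "(F, A) \<in> parcs (class_digraph \<F>)"
      using class_arcI[OF kernel_subset[OF F(1)] A(1) F(2)] by blast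
    then have "C.awalk F ((F, A) # q) B"
      using Bq(3) kernel_subset[OF F(1)] by (simp add: awalk_pcas)
    then have "k \<le> length ((F, A) # q)"
    proof (rule kernel_walk_length[OF F(1) B])
      show "\<forall>(X, Y) \<in> set ((F, A) # q). X \<noteq> Y" using Bq(5) False F(1) by auto
    qed simp
    with Bq(4) show ?thesis by simp
  qed
qed

section \<open>Absorption by the picked vertices\<close>

lemma picked_absorbing_walk:
  assumes "F \<in> \<S>"
  shows "pcas A q F \<Longrightarrow> set q \<subseteq> parcs (class_digraph \<F>) \<Longrightarrow> A \<in> \<F> \<Longrightarrow> z \<in> Field A \<Longrightarrow>
    \<exists>n\<in>picked_vertices. \<exists>p. awalk z p n \<and> H_length H \<rho> p \<le> length q + 1"
proof (induct q arbitrary: A z)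
  case Nil
  then have z: "z \<in> Field F" "z \<in> pverts D" using Field_class_subset by auto
  obtain n where n: "n \<in> picked_vertices" "(z, n) \<in> F\<^sup>*"
    using picked_reachable[OF assms z(1)] .
  \<comment> \<open>This final stretch inside \<open>F\<close> is the \<open>+ 1\<close> in the
    bound.\<close>
  obtain p where "awalk z p n" "H_length H \<rho> p = 1"
    using walk_in_class[OF kernel_subset[OF assms] n(2) z(2)] .
  with n(1) show ?case by (intro bexI[of _ n] exI[of _ p]) simp_all
next
  case (Cons a q)
  obtain B where a: "a = (A, B)" using Cons.prems(1) by (cases a) auto
  have arc: "(A, B) \<in> parcs (class_digraph \<F>)" using Cons.prems(2) a by simp
  have B: "B \<in> \<F>" using arc by (simp add: class_digraph_def)
  have "z \<in> pverts (arc_induced A)"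
    using Cons.prems(4) by (auto simp: arc_induced_def Field_def Domain_fst Range_snd)
  then obtain w r where w: "w \<in> pverts (arc_induced B)"
    and r: "pre_digraph.apath (with_proj (arc_induced A)) z r w"
    using preservative arc unfolding walk_preservative_def by blast
  have wB: "w \<in> Field B"
    using w by (auto simp: arc_induced_def Field_def Domain_fst Range_snd)
  \<comment> \<open>Each arc of the class walk costs one stretch inside its tail class; an empty
    stretch also has H-length 1.\<close>
  have "pcas z r w" "set r \<subseteq> A"
    using r by (auto simp: pre_digraph.apath_def awalk_pcas arc_induced_def)
  then have "(z, w) \<in> A\<^sup>*" by (rule pcas_rtrancl)
  moreover have "z \<in> pverts D" using Cons.prems(3,4) Field_class_subset by auto
  ultimately obtain p1 where p1: "awalk z p1 w" "H_length H \<rho> p1 = 1"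
    using walk_in_class[OF Cons.prems(3)] by blast
  obtain n p2 where n: "n \<in> picked_vertices"
    and p2: "awalk w p2 n" "H_length H \<rho> p2 \<le> length q + 1"
    using Cons.hyps[of B w] Cons.prems(1,2) a B wB by auto
  have "awalk z (p1 @ p2) n" using p1(1) p2(1) by (auto simp: awalk_pcas intro: pcas_append)
  moreover have "H_length H \<rho> (p1 @ p2) \<le> length (a # q) + 1"
    using H_length_append_le[of H \<rho> p1 p2] p1(2) p2(2) by simp
  ultimately show ?case using n by blast
qed

lemma picked_absorbing:
  assumes "x \<in> Field (parcs D)"
  shows "\<exists>n\<in>picked_vertices. \<exists>p. awalk x p n \<and> H_length H \<rho> p \<le> l + 1"
proof -
  obtain A where A: "A \<in> \<F>" "x \<in> Field A"
  proof -
    obtain e where e: "e \<in> parcs D" "x = fst e \<or> x = snd e"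
      using assms by (force simp: Field_def)
    obtain A where "A \<in> \<F>" "e \<in> A" using class_of_arc[OF e(1)] .
    with e(2) that show thesis by (cases e) (auto intro: FieldI1 FieldI2)
  qed
  obtain F q where F: "F \<in> \<S>" "pcas A q F" "set q \<subseteq> parcs (class_digraph \<F>)" "length q \<le> l"
  \<comment> \<open>Kernel absorption concerns classes outside \<open>\<S>\<close>; a class inside
    takes the empty class walk.\<close>
  proof (cases "A \<in> \<S>")
    case True
    then show thesis using that[of A "[]"] by simp
  next
    case False
    then have "\<exists>F\<in>\<S>. \<exists>q. C.awalk A q F \<and> length q \<le> l"
      using kernel A(1) by (simp add: kl_kernel_def)
    then obtain F q where "F \<in> \<S>" "C.awalk A q F" "length q \<le> l" by blast
    then show thesis using that by (auto simp: awalk_pcas)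
  qed
  then show ?thesis using picked_absorbing_walk[OF F(1-3) A] by fastforce
qed

section \<open>Assembling the kernel by walks\<close>

lemma picked_kernel:
  assumes "parcs D \<noteq> {}"
  shows "klH_kernel_by_walks H D \<rho> k (l + 1) picked_vertices"
proof -
  have "x \<in> Field (parcs D)" if "x \<in> pverts D" for x
  proof -
    \<comment> \<open>No vertex is isolated: \<open>x\<close> is the tail \<open>u\<close> or has an
      out-arc on its way there.\<close>
    obtain u v where uv: "(u, v) \<in> parcs D" using assms by auto
    then have "(x, u) \<in> (parcs D)\<^sup>*"
      using vertices_rtrancl[OF that] wellformed'(1) by blast
    then show ?thesis
      using uv by (cases rule: converse_rtranclE) (auto simp: Field_def)
  qed
  moreover have "picked_vertices \<subseteq> pverts D"
    using Field_class_subset kernel_subset unfolding picked_vertices_def by blast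
  ultimately show ?thesis
    using picked_independent picked_absorbing unfolding klH_kernel_by_walks_def by blast
qed

text \<open>Without arcs there are no classes and nothing is picked, but strong connectivity leaves
  just one vertex.\<close>

lemma single_vertex_kernel:
  assumes "parcs D = {}"
  shows "\<exists>x. klH_kernel_by_walks H D \<rho> k m {x}"
proof -
  obtain x where x: "x \<in> pverts D" using conn by (auto simp: strongly_connected_def)
  have "y = x" if "y \<in> pverts D" for y
    using vertices_rtrancl[OF x that] assms by simp
  with x show ?thesis by (auto simp: klH_kernel_by_walks_def)
qed

end

theorem theorem6:
  fixes H :: "'c pair_pre_digraph"
    and D :: "'a pair_pre_digraph"
    and \<rho> :: "'a \<times> 'a \<Rightarrow> 'c"
    and \<F> :: "('a \<times> 'a) set set"
    and \<S> :: "('a \<times> 'a) set set"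
    and k l :: nat
  assumes "H_colored_digraph H D \<rho>"
    and "strongly_connected D"
    and "H_class_partition H D \<rho> \<F>"
    and "walk_preservative \<F>"
    and "k \<ge> 2" and "l \<ge> 1"
    and "kl_kernel (class_digraph \<F>) k l \<S>"
    and "\<And>p. pre_digraph.cycle (class_digraph \<F>) p \<Longrightarrow> length p = 1 \<or> k \<le> length p"
    and "\<And>x. x \<in> pverts D \<Longrightarrow> classes_at \<F> x \<inter> \<S> \<noteq> {} \<Longrightarrow>
           classes_at \<F> x \<inter> proper_out_nbhd (class_digraph \<F>) \<S> \<noteq> {} \<Longrightarrow>
           in_classes \<F> x \<subseteq> \<S>"
  shows "\<exists>N. klH_kernel_by_walks H D \<rho> k (l + 1) N"
proof -
  interpret pair_digraph D
    using assms(1) by (simp add: H_colored_digraph_def)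
  interpret H_classes_kernel D H \<rho> \<F> \<S> k l
    using assms by unfold_locales auto
  show ?thesis
    using picked_kernel single_vertex_kernel by blast
qed

end
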